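(* Let $R=R(q)$ be a Hecke symmetry on $V\otimes V$, $\dim_{\mathbb C}V=N$, which is a deformation of the usual flip $P$, let $r$ be the corresponding classical $r$-matrix, and let $\{\,,\,\}_r$ be the Poisson bracket on the commutative algebra $\mathrm{Sym}(gl(N))=\mathbb{C}[l_i^j]_{1\le i,j\le N}$ given on the generating matrix $L=\|l_i^j\|_{1\le i,j\le N}$ by $$\{L_1,L_2\}_r=r_{21}L_1L_2-L_1L_2r_{12}+L_2r_{12}L_1-L_1r_{21}L_2 .$$ Then the elements $\mathrm{Tr}\,L^k$ are Poisson central with respect to this bracket: $$\{l_i^j,\mathrm{Tr}\,L^k\}_r=0\qquad\text{for all } k\ge 0,\ 1\le i,j\le N .$$
   Context: Let $V$ be a complex vector space of dimension $N$ with a fixed basis; operators on $V^{\otimes 2}$ are identified with their $N^2\times N^2$ matrices, and $P$ is the usual flip on $V\otimes V$. A braiding is an operator $R:V^{\otimes2}\to V^{\otimes2}$ with $(R\otimes I)(I\otimes R)(R\otimes I)=(I\otimes R)(R\otimes I)(I\otimes R)$. A Hecke symmetry is a braiding with $(qI-R)(q^{-1}I+R)=0$, where $q\in\mathbb C^\times$, $q\ne\pm1$. "$R$ is a deformation of the usual flip" means that $R=R(q)$ depends on $q$ and tends to $P$ as $q\to1$. Putting $h=\log q$, the classical $r$-matrix $r=r_{12}$ is the numerical matrix defined by the expansion $$P_{12}R_{12}=I+h\,r_{12}+o(h),$$ and $r_{21}=P_{12}r_{12}P_{12}$. The matrix $r$ satisfies the classical Yang–Baxter equation $[r_{12},r_{13}]+[r_{12},r_{23}]+[r_{13},r_{23}]=0$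 and the relation $r_{12}+r_{21}=2P_{12}$; these two relations guarantee that the formula for $\{\,,\,\}_r$ defines a Poisson bracket. Here $L_1=L\otimes I$ and $L_2=I\otimes L$ are matrices with entries in the commutative algebra $\mathrm{Sym}(gl(N))$, which is the polynomial algebra in the $N^2$ commuting variables $l_i^j$. The symbol $\{L_1,L_2\}_r$ denotes the $N^2\times N^2$ matrix whose entries are the brackets $\{l_i^j,l_k^s\}_r$ (the same placement of indices as in $L\otimes L$); the bracket is extended to the whole algebra by the Leibniz rule. $\mathrm{Tr}$ is the usual trace. *)

theory Defs
  imports
    "HOL-Analysis.Analysis"
    "HOL-Library.Poly_Mapping"
    "HOL-Library.Landau_Symbols"
begin

text \<open>
  \<open>V\<close> is the space with basis indexed by the finite type \<open>'n\<close>, so that \<open>N = CARD('n)\<close>. An operator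
  on \<open>V \<otimes> V\<close> is its matrix, indexed by \<open>'n \<times> 'n\<close>; an operator on \<open>V \<otimes> V \<otimes> V\<close> is a matrix
  indexed by \<open>'n \<times> 'n \<times> 'n\<close>. Products of matrices are always taken with \<open>**\<close>, since \<open>*\<close> and \<open>^\<close>
  act componentwise on the type of vectors.
\<close>

definition kronecker :: "'a::semiring_1^'m::finite^'m \<Rightarrow> 'a^'n::finite^'n \<Rightarrow> 'a^('m \<times> 'n)^('m \<times> 'n)" where
  "kronecker A B = (\<chi> x y. A $ fst x $ fst y * B $ snd x $ snd y)"

text \<open>\<open>R \<otimes> I\<close> and \<open>I \<otimes> R\<close>; the first one is reassociated to the index type of the second one.\<close>

definition tensor_id :: "'a::semiring_1^('n::finite \<times> 'n)^('n \<times> 'n) \<Rightarrow> 'a^('n \<times> 'n \<times> 'n)^('n \<times> 'n \<times> 'n)" where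
  "tensor_id R = (\<chi> x y. case x of (a, b, c) \<Rightarrow> case y of (a', b', c') \<Rightarrow>
     kronecker R (mat 1 :: 'a^'n^'n) $ ((a, b), c) $ ((a', b'), c'))"

definition id_tensor :: "'a::semiring_1^('n::finite \<times> 'n)^('n \<times> 'n) \<Rightarrow> 'a^('n \<times> 'n \<times> 'n)^('n \<times> 'n \<times> 'n)" where
  "id_tensor R = kronecker (mat 1) R"

definition flip :: "'a::semiring_1^('n::finite \<times> 'n)^('n \<times> 'n)" where
  "flip = (\<chi> x y. if x = prod.swap y then 1 else 0)"

definition braiding :: "complex^('n::finite \<times> 'n)^('n \<times> 'n) \<Rightarrow> bool" where
  "braiding R \<longleftrightarrow>
     tensor_id R ** id_tensor R ** tensor_id R = id_tensor R ** tensor_id R ** id_tensor R"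

definition hecke_symmetry :: "complex \<Rightarrow> complex^('n::finite \<times> 'n)^('n \<times> 'n) \<Rightarrow> bool" where
  "hecke_symmetry q R \<longleftrightarrow> q \<noteq> 0 \<and> q \<noteq> 1 \<and> q \<noteq> -1 \<and> braiding R \<and>
     (mat q - R) ** (mat (inverse q) + R) = 0"

text \<open>
  The family only has to be defined for \<open>q\<close> in some punctured neighbourhood of \<open>1\<close>.
\<close>

definition hecke_deformation_of_flip :: "(complex \<Rightarrow> complex^('n::finite \<times> 'n)^('n \<times> 'n)) \<Rightarrow> bool" where
  "hecke_deformation_of_flip R \<longleftrightarrow>
     (\<forall>\<^sub>F q in at 1. hecke_symmetry q (R q)) \<and> (R \<longlongrightarrow> flip) (at 1)"

text \<open>\<open>P R(q) = I + h r + o(h)\<close> with \<open>h = log q\<close>, read entry by entry.\<close>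

definition classical_r_matrix ::
  "(complex \<Rightarrow> complex^('n::finite \<times> 'n)^('n \<times> 'n)) \<Rightarrow> complex^('n \<times> 'n)^('n \<times> 'n) \<Rightarrow> bool" where
  "classical_r_matrix R r \<longleftrightarrow>
     (\<forall>x y. (\<lambda>q. (flip ** R q) $ x $ y - (mat 1 $ x $ y + Ln q * r $ x $ y)) \<in> o[at 1](Ln))"

definition swap_legs :: "'a::semiring_1^('n::finite \<times> 'n)^('n \<times> 'n) \<Rightarrow> 'a^('n \<times> 'n)^('n \<times> 'n)" where
  "swap_legs r = flip ** r ** flip"

text \<open>
  The polynomial algebra in the variables \<open>l i j\<close>, indexed by \<open>(i, j)\<close>: finitely supported
  functions from monomials (finitely supported exponent functions) to coefficients,
  with the convolution product.
\<close>

type_synonym 'n sym_gl = "(('n \<times> 'n) \<Rightarrow>\<^sub>0 nat) \<Rightarrow>\<^sub>0 complex"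

definition const :: "complex \<Rightarrow> 'n sym_gl" where
  "const c = Poly_Mapping.single 0 c"

definition gen :: "'n \<Rightarrow> 'n \<Rightarrow> 'n sym_gl" where
  "gen i j = Poly_Mapping.single (Poly_Mapping.single (i, j) 1) 1"

definition L :: "'n sym_gl^'n^'n" where
  "L = (\<chi> i j. gen i j)"

primrec mat_power :: "'a::semiring_1^'n^'n \<Rightarrow> nat \<Rightarrow> 'a^'n^'n" where
  "mat_power A 0 = mat 1"
| "mat_power A (Suc k) = A ** mat_power A k"

definition L1 :: "'n::finite sym_gl^('n \<times> 'n)^('n \<times> 'n)" where
  "L1 = kronecker L (mat 1)"

definition L2 :: "'n::finite sym_gl^('n \<times> 'n)^('n \<times> 'n)" where
  "L2 = kronecker (mat 1) L"

definition bracket_matrix :: "complex^('n::finite \<times> 'n)^('n \<times> 'n) \<Rightarrow> 'n sym_gl^('n \<times> 'n)^('n \<times> 'n)" where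
  "bracket_matrix r =
     (let r12 = map_matrix const r; r21 = map_matrix const (swap_legs r)
      in r21 ** L1 ** L2 - L1 ** L2 ** r12 + L2 ** r12 ** L1 - L1 ** r21 ** L2)"

definition partial_deriv :: "'n \<times> 'n \<Rightarrow> 'n sym_gl \<Rightarrow> 'n sym_gl" where
  "partial_deriv v p = (\<Sum>m\<in>Poly_Mapping.keys p.
     Poly_Mapping.single (m - Poly_Mapping.single v 1)
       (of_nat (Poly_Mapping.lookup m v) * Poly_Mapping.lookup p m))"

text \<open>
  The bracket is the extension, by bilinearity and the Leibniz rule in both arguments, of the
  prescribed brackets of the generators. The entry of \<open>L \<otimes> L\<close> in row \<open>(i, k)\<close> and column \<open>(j, s)\<close>
  is \<open>l i j * l k s\<close>, so the corresponding entry of \<open>bracket_matrix r\<close> is the bracket of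
  \<open>l i j\<close> and \<open>l k s\<close>. The lemmas \<open>r_bracket_biderivation\<close>, \<open>r_bracket_L1_L2\<close> and
  \<open>r_bracket_unique\<close> below confirm that this is the extension meant. Skew symmetry and the
  Jacobi identity are not imposed: they are consequences of \<open>r + swap_legs r = 2 P\<close> and of the
  classical Yang-Baxter equation, which hold for the \<open>r\<close> obtained from a family of Hecke symmetries.
\<close>

definition r_bracket ::
  "complex^('n::finite \<times> 'n)^('n \<times> 'n) \<Rightarrow> 'n sym_gl \<Rightarrow> 'n sym_gl \<Rightarrow> 'n sym_gl" where
  "r_bracket r f g = (\<Sum>(i, j)\<in>UNIV. \<Sum>(k, s)\<in>UNIV.
     partial_deriv (i, j) f * partial_deriv (k, s) g * bracket_matrix r $ (i, k) $ (j, s))"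

definition poisson_central :: "('a \<Rightarrow> 'a \<Rightarrow> 'a::zero) \<Rightarrow> 'a \<Rightarrow> bool" where
  "poisson_central B z \<longleftrightarrow> (\<forall>f. B f z = 0)"

definition derivation :: "('n sym_gl \<Rightarrow> 'n sym_gl) \<Rightarrow> bool" where
  "derivation D \<longleftrightarrow> (\<forall>f g. D (f + g) = D f + D g) \<and> (\<forall>c f. D (const c * f) = const c * D f) \<and>
     (\<forall>f g. D (f * g) = D f * g + f * D g)"

lemma poly_mapping_sum_single:
  fixes p :: "'a \<Rightarrow>\<^sub>0 'b::comm_monoid_add"
  shows "p = (\<Sum>m\<in>Poly_Mapping.keys p. Poly_Mapping.single m (Poly_Mapping.lookup p m))"
  by (rule poly_mapping_eqI) (auto simp: lookup_sum lookup_single when_def in_keys_iff)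

lemma partial_deriv_superset:
  assumes "finite S" "Poly_Mapping.keys p \<subseteq> S"
  shows "partial_deriv v p = (\<Sum>m\<in>S. Poly_Mapping.single (m - Poly_Mapping.single v 1)
       (of_nat (Poly_Mapping.lookup m v) * Poly_Mapping.lookup p m))"
  unfolding partial_deriv_def
  by (rule sum.mono_neutral_left) (use assms in \<open>auto simp: in_keys_iff\<close>)

lemma partial_deriv_single:
  "partial_deriv v (Poly_Mapping.single m a) =
     Poly_Mapping.single (m - Poly_Mapping.single v 1) (of_nat (Poly_Mapping.lookup m v) * a)"
  by (subst partial_deriv_superset[of "{m}"]) auto

lemma partial_deriv_add: "partial_deriv v (p + q) = partial_deriv v p + partial_deriv v q"
  by (subst (1 2 3) partial_deriv_superset[of "Poly_Mapping.keys p \<union> Poly_Mapping.keys q"])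
     (use keys_add[of p q] in
       \<open>auto simp: lookup_add distrib_left single_add sum.distrib\<close>)

lemma partial_deriv_zero: "partial_deriv v 0 = 0"
  by (simp add: partial_deriv_def)

lemma partial_deriv_sum: "partial_deriv v (sum f A) = (\<Sum>x\<in>A. partial_deriv v (f x))"
  by (induction A rule: infinite_finite_induct) (auto simp: partial_deriv_add partial_deriv_zero)

lemma partial_deriv_mult_single:
  "partial_deriv v (Poly_Mapping.single m a * Poly_Mapping.single n b) =
     partial_deriv v (Poly_Mapping.single m a) * Poly_Mapping.single n b
     + Poly_Mapping.single m a * partial_deriv v (Poly_Mapping.single n b)"
proof -
  have shift: "(m - Poly_Mapping.single v 1) + n = m + n - Poly_Mapping.single v 1"
    if "Poly_Mapping.lookup m v \<noteq> 0" for m n :: "('a \<times> 'a) \<Rightarrow>\<^sub>0 nat"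
    by (rule poly_mapping_eqI)
       (use that in \<open>auto simp: lookup_add lookup_minus lookup_single when_def\<close>)
  have "Poly_Mapping.single ((m - Poly_Mapping.single v 1) + n) (of_nat (Poly_Mapping.lookup m v) * a * b)
      = Poly_Mapping.single (m + n - Poly_Mapping.single v 1) (of_nat (Poly_Mapping.lookup m v) * a * b)"
    using shift[of m n] by (cases "Poly_Mapping.lookup m v = 0") auto
  moreover have "Poly_Mapping.single (m + (n - Poly_Mapping.single v 1)) (a * (of_nat (Poly_Mapping.lookup n v) * b))
      = Poly_Mapping.single (m + n - Poly_Mapping.single v 1) (a * (of_nat (Poly_Mapping.lookup n v) * b))"
    using shift[of n m] by (cases "Poly_Mapping.lookup n v = 0") (auto simp: add.commute)
  ultimately show ?thesis
    by (simp add: partial_deriv_single mult_single lookup_add flip: single_add)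
       (simp add: algebra_simps)
qed

lemma partial_deriv_mult: "partial_deriv v (p * q) = partial_deriv v p * q + p * partial_deriv v q"
proof -
  have *: "partial_deriv v (Poly_Mapping.single m a * q) =
     partial_deriv v (Poly_Mapping.single m a) * q + Poly_Mapping.single m a * partial_deriv v q" for m a
    by (subst (1 2 3) poly_mapping_sum_single[of q])
       (simp add: sum_distrib_left partial_deriv_sum partial_deriv_mult_single sum.distrib)
  show ?thesis
    by (subst (1 2 3) poly_mapping_sum_single[of p])
       (simp add: sum_distrib_right partial_deriv_sum * sum.distrib)
qed

lemma derivation_partial_deriv: "derivation (partial_deriv v)"
  by (simp add: derivation_def partial_deriv_add partial_deriv_mult const_def partial_deriv_single)

lemma derivation_combination:
  assumes "\<And>x. x \<in> A \<Longrightarrow> derivation (D x)"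
  shows "derivation (\<lambda>f. \<Sum>x\<in>A. D x f * c x)"
proof -
  have add: "D x (f + g) = D x f + D x g" and scale: "D x (const k * f) = const k * D x f"
    and leibniz: "D x (f * g) = D x f * g + f * D x g" if "x \<in> A" for x f g k
    using assms[OF that] unfolding derivation_def by blast+
  have "(\<Sum>x\<in>A. D x (f + g) * c x) = (\<Sum>x\<in>A. D x f * c x) + (\<Sum>x\<in>A. D x g * c x)" for f g
    unfolding sum.distrib[symmetric] by (intro sum.cong refl) (simp only: add distrib_right)
  moreover have "(\<Sum>x\<in>A. D x (const k * f) * c x) = const k * (\<Sum>x\<in>A. D x f * c x)" for k f
    unfolding sum_distrib_left by (intro sum.cong refl) (simp only: scale mult.assoc)
  moreover have "(\<Sum>x\<in>A. D x (f * g) * c x) =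
      (\<Sum>x\<in>A. D x f * c x) * g + f * (\<Sum>x\<in>A. D x g * c x)" for f g
    unfolding sum_distrib_left sum_distrib_right sum.distrib[symmetric]
    by (intro sum.cong refl) (simp only: leibniz distrib_right distrib_left mult_ac)
  ultimately show ?thesis
    unfolding derivation_def by blast
qed

lemma r_bracket_biderivation:
  "derivation (\<lambda>f. r_bracket r f g)" "derivation (\<lambda>g. r_bracket r f g)"
proof -
  have "(\<lambda>f. r_bracket r f g) = (\<lambda>f. \<Sum>v\<in>UNIV. partial_deriv v f *
     (\<Sum>w\<in>UNIV. partial_deriv w g * bracket_matrix r $ (fst v, fst w) $ (snd v, snd w)))"
    by (simp add: r_bracket_def case_prod_unfold sum_distrib_left mult.assoc)
  then show "derivation (\<lambda>f. r_bracket r f g)"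
    by (simp only:) (intro derivation_combination derivation_partial_deriv)
  have "(\<lambda>g. r_bracket r f g) = (\<lambda>g. \<Sum>w\<in>UNIV. partial_deriv w g *
     (\<Sum>v\<in>UNIV. partial_deriv v f * bracket_matrix r $ (fst v, fst w) $ (snd v, snd w)))"
    unfolding r_bracket_def case_prod_unfold
    by (subst sum.swap) (simp add: sum_distrib_left algebra_simps)
  then show "derivation (\<lambda>g. r_bracket r f g)"
    by (simp only:) (intro derivation_combination derivation_partial_deriv)
qed

lemma partial_deriv_gen: "partial_deriv v (gen i j) = (if v = (i, j) then 1 else 0)"
  by (auto simp: gen_def partial_deriv_single lookup_single when_def)

lemma r_bracket_L1_L2: "r_bracket r (gen i j) (gen k s) = bracket_matrix r $ (i, k) $ (j, s)"
proof -
  have if_mult: "(if b then y else 0) * x = (if b then y * x else 0)" for b and x y :: "'a sym_gl"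
    by simp
  have sum_if: "(\<Sum>w\<in>UNIV. if b then h w else 0) = (if b then (\<Sum>w\<in>UNIV. h w) else 0)"
    for b and h :: "'a \<times> 'a \<Rightarrow> 'a sym_gl"
    by simp
  show ?thesis
    unfolding r_bracket_def case_prod_unfold
    by (simp add: partial_deriv_gen if_mult sum_if del: mult_eq_0_iff)
qed

lemma derivation_eqI:
  assumes D: "derivation D" and E: "derivation E" and eq: "\<And>i j. D (gen i j) = E (gen i j)"
  shows "D f = E f"
proof -
  have D0: "D (const c) = 0" if "derivation D" for D :: "'a sym_gl \<Rightarrow> 'a sym_gl" and c
  proof -
    have "D (1 * 1) = D 1 * 1 + 1 * D 1" using that unfolding derivation_def by blast
    then have "D 1 = 0" by simp
    moreover have "D (const c * 1) = const c * D 1" using that unfolding derivation_def by blast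
    ultimately show ?thesis by simp
  qed
  have "const 0 = (0 :: 'a sym_gl)" and "const 1 = (1 :: 'a sym_gl)" by (simp_all add: const_def)
  then have one: "D 1 = E 1" and zero: "D 0 = E 0" using D0[OF D] D0[OF E] by metis+
  have mult: "D (p * q) = E (p * q)" if "D p = E p" "D q = E q" for p q
    using that D E by (simp add: derivation_def)
  have var: "D (Poly_Mapping.single (Poly_Mapping.single v n) 1) = E (Poly_Mapping.single (Poly_Mapping.single v n) 1)" for v n
  proof (induction n)
    case 0
    then show ?case using one by simp
  next
    case (Suc n)
    have "Poly_Mapping.single (Poly_Mapping.single v (Suc n)) 1 =
        gen (fst v) (snd v) * Poly_Mapping.single (Poly_Mapping.single v n) 1"
      by (simp add: gen_def mult_single flip: single_add)
    then show ?case using mult[OF eq Suc] by simp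
  qed
  have mono: "D (Poly_Mapping.single (sum (\<lambda>v. Poly_Mapping.single v (e v)) S) 1) =
      E (Poly_Mapping.single (sum (\<lambda>v. Poly_Mapping.single v (e v)) S) 1)" if "finite S" for S and e
    using that
  proof (induction S)
    case empty
    then show ?case using one by simp
  next
    case (insert v S)
    then show ?case using mult[OF var[of v "e v"] insert.IH] by (simp add: mult_single)
  qed
  have "D (Poly_Mapping.single m c) = E (Poly_Mapping.single m c)" for m c
  proof -
    have "D (Poly_Mapping.single m 1) = E (Poly_Mapping.single m 1)"
      using mono[of "Poly_Mapping.keys m" "Poly_Mapping.lookup m"] poly_mapping_sum_single[of m] by simp
    moreover have "Poly_Mapping.single m c = const c * Poly_Mapping.single m 1"
      by (simp add: const_def mult_single)
    moreover have "D (const c) = E (const c)" using D0[OF D] D0[OF E] by simp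
    ultimately show ?thesis using mult by simp
  qed
  moreover have "D (sum g S) = E (sum g S)" if "finite S" "\<And>x. D (g x) = E (g x)"
    for g :: "(('a \<times> 'a) \<Rightarrow>\<^sub>0 nat) \<Rightarrow> 'a sym_gl" and S
    using that(1)
    by (induction S) (use D E zero that(2) in \<open>auto simp: derivation_def\<close>)
  ultimately show ?thesis
    by (subst (1 2) poly_mapping_sum_single) simp
qed

lemma r_bracket_unique:
  assumes "\<And>g. derivation (\<lambda>f. B f g)" "\<And>f. derivation (\<lambda>g. B f g)"
    and "\<And>i j k s. B (gen i j) (gen k s) = bracket_matrix r $ (i, k) $ (j, s)"
  shows "B = r_bracket r"
proof -
  have *: "B (gen i j) g = r_bracket r (gen i j) g" for i j g
    by (rule derivation_eqI[where D = "B (gen i j)"])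
       (use assms(2) r_bracket_biderivation(2) in \<open>simp_all add: assms(3) r_bracket_L1_L2\<close>)
  have "B f g = r_bracket r f g" for f g
    by (rule derivation_eqI[where D = "\<lambda>f. B f g" and E = "\<lambda>f. r_bracket r f g"])
       (use assms(1) r_bracket_biderivation(1) * in simp_all)
  then show ?thesis by blast
qed

end

theory Submission
  imports Defs
begin

text \<open>
  Write \<open>Tr\<^sub>2\<close> for the partial trace over the second tensor factor. By the Leibniz rule and cyclicity
  of the trace, the brackets of the entries of \<open>L\<close> with \<open>Tr L\<^sup>m\<^sup>+\<^sup>1\<close> form the matrix
  \<open>(m + 1) Tr\<^sub>2 ({L\<^sub>1, L\<^sub>2} L\<^sub>2\<^sup>m)\<close>. As \<open>L\<^sub>1\<close> commutes with \<open>L\<^sub>2\<close>, and \<open>Tr\<^sub>2\<close> is cyclic for factors acting in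
  the second space, the four terms of the bracket combine to \<open>[Tr\<^sub>2 ((r\<^sub>1\<^sub>2 + r\<^sub>2\<^sub>1) L\<^sub>2\<^sup>m\<^sup>+\<^sup>1), L]\<close>. The Hecke
  relation gives \<open>r\<^sub>1\<^sub>2 + r\<^sub>2\<^sub>1 = 2 P\<close>, so this is \<open>2 [L\<^sup>m\<^sup>+\<^sup>1, L] = 0\<close>.
\<close>

section \<open>Entries of matrix products with scalar matrices and the flip\<close>

lemma matrix_add_rdistrib: "(A + B) ** C = A ** C + B ** C"
  by (simp add: vec_eq_iff matrix_matrix_mult_def distrib_right sum.distrib)

lemma matrix_diff_rdistrib: "(A - B) ** C = A ** C - B ** (C :: 'a::ring_1^_^_)"
  by (simp add: vec_eq_iff matrix_matrix_mult_def left_diff_distrib sum_subtractf)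

lemma if_zero_mult: "(if b then c else 0) * a = (if b then c * a else (0::'a::semiring_0))"
  by simp

lemma mult_if_zero: "a * (if b then c else 0) = (if b then a * c else (0::'a::semiring_0))"
  by simp

text \<open>Read from left to right, this frees the summation variable from the swap, so that the
  delta sum in \<open>flip_mult_nth\<close> collapses.\<close>

lemma eq_swap_iff: "x = prod.swap y \<longleftrightarrow> prod.swap x = y"
  by auto

lemma mat_mult_nth: "(mat c ** A) $ x $ y = c * A $ x $ y"
  by (simp add: matrix_matrix_mult_def mat_def if_zero_mult)

lemma mult_mat_nth: "(A ** mat c) $ x $ y = A $ x $ y * c"
  by (simp add: matrix_matrix_mult_def mat_def mult_if_zero)

lemma flip_mult_nth: "(flip ** A) $ x $ y = A $ prod.swap x $ y"
  by (simp add: matrix_matrix_mult_def flip_def if_zero_mult eq_swap_iff)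

lemma mult_flip_nth: "(A ** flip) $ x $ y = A $ x $ prod.swap y"
  by (simp add: matrix_matrix_mult_def flip_def mult_if_zero)

lemma swap_legs_nth: "swap_legs r $ x $ y = r $ prod.swap x $ prod.swap y"
  by (simp add: swap_legs_def flip_mult_nth mult_flip_nth)

section \<open>First-order expansion of the Hecke relation at \<open>q = 1\<close>\<close>

lemma eventually_Ln_nonzero: "\<forall>\<^sub>F q in at 1. Ln q \<noteq> 0"
proof -
  have "\<forall>\<^sub>F q in at (1::complex). q \<noteq> 0 \<and> q \<noteq> 1"
    using eventually_neq_at_within[of 0 1] eventually_neq_at_within[of 1 1]
    by (rule eventually_conj)
  then show ?thesis
    \<comment> \<open>\<open>Ln q = 0\<close> would give \<open>q = exp 0 = 1\<close>.\<close>
    by eventually_elim (metis exp_Ln exp_zero)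
qed

text \<open>Division by \<open>Ln q\<close>, which is nonzero near 1, turns the remainder
  \<open>o(Ln q)\<close> into a term tending to 0.\<close>

lemma classical_r_matrix_tendsto:
  assumes "classical_r_matrix R r"
  shows "((\<lambda>q. ((flip ** R q) $ x $ y - mat 1 $ x $ y) / Ln q) \<longlongrightarrow> r $ x $ y) (at 1)"
proof -
  have "((\<lambda>q. ((flip ** R q) $ x $ y - (mat 1 $ x $ y + Ln q * r $ x $ y)) / Ln q) \<longlongrightarrow> 0) (at 1)"
    using assms unfolding classical_r_matrix_def by (intro smalloD_tendsto) blast
  then have *: "((\<lambda>q. ((flip ** R q) $ x $ y - (mat 1 $ x $ y + Ln q * r $ x $ y)) / Ln q + r $ x $ y)
      \<longlongrightarrow> r $ x $ y) (at 1)"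
    using tendsto_add[OF _ tendsto_const] by fastforce
  show ?thesis
    by (rule Lim_transform_eventually[OF *])
       (use eventually_Ln_nonzero in eventually_elim, simp add: field_simps)
qed

text \<open>In the expanded product the scalar terms give \<open>q * inverse q = 1\<close>, which
  uses \<open>q \<noteq> 0\<close>. The entrywise form suits the entrywise limits below.\<close>

lemma hecke_quadratic:
  assumes "hecke_symmetry q R"
  shows "(\<Sum>z\<in>UNIV. R $ x $ z * R $ z $ y) = mat 1 $ x $ y + (q - inverse q) * R $ x $ y"
proof -
  have "q \<noteq> 0" and "(mat q - R) ** (mat (inverse q) + R) = 0"
    using assms by (auto simp: hecke_symmetry_def)
  then have "(mat q ** mat (inverse q) - R ** mat (inverse q) + (mat q ** R - R ** R)) $ x $ y = 0"
    by (simp add: matrix_add_ldistrib matrix_diff_rdistrib)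
  then have "mat 1 $ x $ y - R $ x $ y * inverse q + (q * R $ x $ y - (R ** R) $ x $ y) = 0"
    using \<open>q \<noteq> 0\<close> by (simp add: mat_mult_nth mult_mat_nth) (simp add: mat_def split: if_splits)
  then show ?thesis
    by (simp add: matrix_matrix_mult_def algebra_simps)
qed

text \<open>The numerator is \<open>(q - 1) * (q + 1) / q\<close>, and \<open>Ln q / (q - 1)\<close>
  tends to the derivative of \<open>Ln\<close> at 1, which is 1.\<close>

lemma tendsto_diff_inverse_div_Ln: "((\<lambda>q. (q - inverse q) / Ln q) \<longlongrightarrow> 2) (at 1)"
proof -
  have "(Ln has_field_derivative inverse 1) (at 1)"
    by (rule has_field_derivative_Ln) simp
  then have *: "((\<lambda>q. Ln q / (q - 1)) \<longlongrightarrow> 1) (at 1)"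
    by (simp add: has_field_derivative_iff)
  have "((\<lambda>q::complex. ((q + 1) / q) / (Ln q / (q - 1))) \<longlongrightarrow> ((1 + 1) / 1) / 1) (at 1)"
    by (intro tendsto_divide tendsto_add tendsto_const tendsto_ident_at *) auto
  then have **: "((\<lambda>q::complex. ((q + 1) / q) / (Ln q / (q - 1))) \<longlongrightarrow> 2) (at 1)"
    by simp
  show ?thesis
  proof (rule Lim_transform_eventually[OF **])
    show "\<forall>\<^sub>F q in at (1::complex). (q + 1) / q / (Ln q / (q - 1)) = (q - inverse q) / Ln q"
      using eventually_neq_at_within[of 0 1] eventually_neq_at_within[of 1 1] eventually_Ln_nonzero
      by eventually_elim (simp add: field_simps)
  qed
qed

text \<open>The \<open>h\<close>-linear part of \<open>R\<^sup>2 = I + (q - q\<^sup>-\<^sup>1) R\<close>, with \<open>R = P (I + h D)\<close>.\<close>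

lemma add_swap_legs_eq:
  assumes R: "hecke_deformation_of_flip R" and r: "classical_r_matrix R r"
  shows "r + swap_legs r = flip + flip"
proof -
  define D where "D q x y = ((flip ** R q) $ x $ y - mat 1 $ x $ y) / Ln q" for q x y
  have D: "((\<lambda>q. D q x y) \<longlongrightarrow> r $ x $ y) (at 1)" for x y
    unfolding D_def by (rule classical_r_matrix_tendsto[OF r])
  have Rlim: "((\<lambda>q. R q $ x $ y) \<longlongrightarrow> flip $ x $ y) (at 1)" for x y
    using R unfolding hecke_deformation_of_flip_def by (intro tendsto_vec_nth) simp
  have Ln: "(Ln \<longlongrightarrow> 0) (at 1)"
    using tendsto_Ln[OF tendsto_ident_at, of 1 UNIV] by simp
  \<comment> \<open>Both sides are limits of \<open>(q - inverse q) / Ln q * R q $ x $ y\<close>: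
    the right one directly, the left one through the Hecke relation.\<close>
  have "r $ x $ y + r $ prod.swap x $ prod.swap y = 2 * flip $ x $ y" for x y
  proof (rule tendsto_unique)
    show "((\<lambda>q. (q - inverse q) / Ln q * R q $ x $ y) \<longlongrightarrow> 2 * flip $ x $ y) (at 1)"
      by (intro tendsto_mult tendsto_diff_inverse_div_Ln Rlim)
    \<comment> \<open>The part quadratic in \<open>D\<close> carries a factor \<open>Ln q\<close>,
      so it vanishes in the limit.\<close>
    have "((\<lambda>q. D q x y + D q (prod.swap x) (prod.swap y)
        + Ln q * (\<Sum>z\<in>UNIV. D q (prod.swap x) z * D q (prod.swap z) y)) \<longlongrightarrow>
        r $ x $ y + r $ prod.swap x $ prod.swap y
        + 0 * (\<Sum>z\<in>UNIV. r $ prod.swap x $ z * r $ prod.swap z $ y)) (at 1)"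
      by (intro tendsto_intros D Ln)
    then have *: "((\<lambda>q. D q x y + D q (prod.swap x) (prod.swap y)
        + Ln q * (\<Sum>z\<in>UNIV. D q (prod.swap x) z * D q (prod.swap z) y)) \<longlongrightarrow>
        r $ x $ y + r $ prod.swap x $ prod.swap y) (at 1)"
      by simp
    have "\<forall>\<^sub>F q in at 1. hecke_symmetry q (R q)"
      using R by (simp add: hecke_deformation_of_flip_def)
    then have "\<forall>\<^sub>F q in at 1. D q x y + D q (prod.swap x) (prod.swap y)
        + Ln q * (\<Sum>z\<in>UNIV. D q (prod.swap x) z * D q (prod.swap z) y)
        = (q - inverse q) / Ln q * R q $ x $ y"
      using eventually_Ln_nonzero
    proof eventually_elim
      case (elim q)
      have R_eq: "R q $ u $ v = mat 1 $ prod.swap u $ v + Ln q * D q (prod.swap u) v" for u v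
        using elim(2) by (simp add: D_def flip_mult_nth)
      have delta_left: "(\<Sum>z\<in>UNIV. mat 1 $ u $ z * f z) = f u" for u and f :: "'a \<times> 'a \<Rightarrow> complex"
        by (simp add: mat_def if_distrib if_distribR cong: if_cong)
      have delta_right: "(\<Sum>z\<in>UNIV. f z * mat 1 $ prod.swap z $ y) = f (prod.swap y)"
        for f :: "'a \<times> 'a \<Rightarrow> complex"
      proof -
        have "(\<Sum>z\<in>UNIV. f z * mat 1 $ prod.swap z $ y) = (\<Sum>z\<in>UNIV. if z = prod.swap y then f z else 0)"
          by (rule sum.cong) (auto simp: mat_def)
        then show ?thesis by simp
      qed
      have "mat 1 $ x $ y + (q - inverse q) * R q $ x $ y = (\<Sum>z\<in>UNIV. R q $ x $ z * R q $ z $ y)"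
        by (rule hecke_quadratic[OF elim(1), symmetric])
      \<comment> \<open>The left factor is expanded fully, the right one only where it meets
        \<open>D\<close>; the first two sums then collapse to single entries.\<close>
      also have "\<dots> = (\<Sum>z\<in>UNIV. mat 1 $ prod.swap x $ z * R q $ z $ y)
          + (\<Sum>z\<in>UNIV. Ln q * D q (prod.swap x) z * mat 1 $ prod.swap z $ y)
          + Ln q * (Ln q * (\<Sum>z\<in>UNIV. D q (prod.swap x) z * D q (prod.swap z) y))"
        unfolding sum_distrib_left sum.distrib[symmetric]
        by (rule sum.cong[OF refl], subst R_eq[of x], subst (2) R_eq) (simp add: algebra_simps R_eq)
      also have "\<dots> = mat 1 $ x $ y + Ln q * (D q x y + D q (prod.swap x) (prod.swap y)
          + Ln q * (\<Sum>z\<in>UNIV. D q (prod.swap x) z * D q (prod.swap z) y))"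
        unfolding delta_left delta_right by (subst R_eq) (simp add: algebra_simps)
      finally show ?case
        using elim(2) by (simp add: field_simps)
    qed
    from Lim_transform_eventually[OF * this]
    show "((\<lambda>q. (q - inverse q) / Ln q * R q $ x $ y) \<longlongrightarrow>
        r $ x $ y + r $ prod.swap x $ prod.swap y) (at 1)" .
  qed simp
  then show ?thesis
    by (simp add: vec_eq_iff swap_legs_nth)
qed

section \<open>Kronecker products and the partial trace\<close>

definition partial_trace :: "'a::semiring_1^('m::finite \<times> 'n::finite)^('m \<times> 'n) \<Rightarrow> 'a^'m^'m" where
  "partial_trace X = (\<chi> i j. \<Sum>k\<in>UNIV. X $ (i, k) $ (j, k))"

lemma sum_UNIV_prod: "(\<Sum>x\<in>UNIV. f x) = (\<Sum>i\<in>UNIV. \<Sum>j\<in>UNIV. f (i, j))"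
  by (simp add: sum.cartesian_product)

lemma partial_trace_add: "partial_trace (X + Y) = partial_trace X + partial_trace Y"
  by (simp add: partial_trace_def vec_eq_iff sum.distrib)

lemma partial_trace_diff:
  fixes X Y :: "'a::ring_1^('m::finite \<times> 'n::finite)^('m \<times> 'n)"
  shows "partial_trace (X - Y) = partial_trace X - partial_trace Y"
  by (simp add: partial_trace_def vec_eq_iff sum_subtractf)

text \<open>The entries of \<open>B\<close> and \<open>C\<close> have to change places, hence the
  commutative coefficients.\<close>

lemma kronecker_mult:
  fixes A C :: "'a::comm_semiring_1^'m::finite^'m" and B D :: "'a^'n::finite^'n"
  shows "kronecker A B ** kronecker C D = kronecker (A ** C) (B ** D)"
  by (simp add: vec_eq_iff kronecker_def matrix_matrix_mult_def sum_UNIV_prod sum_product mult_ac)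

lemma sum_if_zero: "(\<Sum>x\<in>A. if b then f x else 0) = (if b then sum f A else 0)"
  by simp

lemma mult_kronecker_mat1_nth:
  "(X ** kronecker (mat 1) B) $ x $ (j, l) = (\<Sum>k\<in>UNIV. X $ x $ (j, k) * B $ k $ l)"
  by (simp add: kronecker_def matrix_matrix_mult_def mat_def sum_UNIV_prod if_zero_mult mult_if_zero
      sum_if_zero)

lemma kronecker_mat1_mult_nth:
  "(kronecker (mat 1) B ** X) $ (i, k) $ y = (\<Sum>l\<in>UNIV. B $ k $ l * X $ (i, l) $ y)"
  by (simp add: kronecker_def matrix_matrix_mult_def mat_def sum_UNIV_prod if_zero_mult mult_if_zero
      sum_if_zero)

lemma mult_kronecker_mat2_nth:
  "(X ** kronecker A (mat 1)) $ x $ (j, l) = (\<Sum>i\<in>UNIV. X $ x $ (i, l) * A $ i $ j)"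
  by (simp add: kronecker_def matrix_matrix_mult_def mat_def sum_UNIV_prod if_zero_mult mult_if_zero
      sum_if_zero)

lemma kronecker_mat2_mult_nth:
  "(kronecker A (mat 1) ** X) $ (i, k) $ y = (\<Sum>j\<in>UNIV. A $ i $ j * X $ (j, k) $ y)"
  by (simp add: kronecker_def matrix_matrix_mult_def mat_def sum_UNIV_prod if_zero_mult mult_if_zero
      sum_if_zero)

text \<open>A factor acting only in the second space involves just the index that is traced out, so
  exchanging the two sums over that space moves it around.\<close>

lemma partial_trace_cyclic:
  fixes X :: "'a::comm_semiring_1^('m::finite \<times> 'n::finite)^('m \<times> 'n)"
  shows "partial_trace (kronecker (mat 1) B ** X) = partial_trace (X ** kronecker (mat 1) B)"
proof -
  have "(\<Sum>k\<in>UNIV. \<Sum>l\<in>UNIV. B $ k $ l * X $ (i, l) $ (j, k)) =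
      (\<Sum>k\<in>UNIV. \<Sum>l\<in>UNIV. X $ (i, k) $ (j, l) * B $ l $ k)" for i j
    by (subst sum.swap) (simp add: mult.commute)
  then show ?thesis
    by (simp add: partial_trace_def vec_eq_iff kronecker_mat1_mult_nth mult_kronecker_mat1_nth)
qed

text \<open>A factor acting only in the first space is constant in the traced index, so it leaves
  the sum on its own side.\<close>

lemma partial_trace_mult_left: "partial_trace (kronecker A (mat 1) ** X) = A ** partial_trace X"
proof -
  have "(\<Sum>k\<in>UNIV. \<Sum>l\<in>UNIV. A $ i $ l * X $ (l, k) $ (j, k)) =
      (\<Sum>l\<in>UNIV. A $ i $ l * (\<Sum>k\<in>UNIV. X $ (l, k) $ (j, k)))" for i j
    by (subst sum.swap) (simp add: sum_distrib_left)
  then show ?thesis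
    by (simp add: partial_trace_def vec_eq_iff kronecker_mat2_mult_nth) (simp add: matrix_matrix_mult_def)
qed

lemma partial_trace_mult_right: "partial_trace (X ** kronecker A (mat 1)) = partial_trace X ** A"
proof -
  have "(\<Sum>k\<in>UNIV. \<Sum>l\<in>UNIV. X $ (i, k) $ (l, k) * A $ l $ j) =
      (\<Sum>l\<in>UNIV. (\<Sum>k\<in>UNIV. X $ (i, k) $ (l, k)) * A $ l $ j)" for i j
    by (subst sum.swap) (simp add: sum_distrib_right)
  then show ?thesis
    by (simp add: partial_trace_def vec_eq_iff mult_kronecker_mat2_nth) (simp add: matrix_matrix_mult_def)
qed

text \<open>The flip turns row \<open>(i, k)\<close> into \<open>(k, i)\<close>; the identity factor
  then forces \<open>k = j\<close>, and the entry \<open>B $ i $ j\<close> remains.\<close>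

lemma partial_trace_flip: "partial_trace (flip ** kronecker (mat 1) B) = B"
  by (simp add: partial_trace_def vec_eq_iff flip_mult_nth)
     (simp add: kronecker_def mat_def if_distrib if_distribR cong: if_cong)

section \<open>The bracket matrix under the partial trace\<close>

lemma mat_power_comm: "mat_power A k ** A = A ** mat_power A k"
  by (induction k) (simp_all flip: matrix_mul_assoc)

lemma map_matrix_const_flip: "map_matrix const flip = flip"
  by (simp add: vec_eq_iff flip_def const_def)

lemma map_matrix_const_add: "map_matrix const (A + B) = map_matrix const A + map_matrix const B"
  by (simp add: vec_eq_iff const_def single_add)

lemma partial_trace_bracket_matrix:
  fixes r :: "complex^('n::finite \<times> 'n)^('n \<times> 'n)"
  assumes "r + swap_legs r = flip + flip"
  shows "partial_trace (bracket_matrix r ** kronecker (mat 1) (mat_power L k)) = 0"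
proof -
  define r12 where "(r12 :: 'n sym_gl^_^_) = map_matrix const r"
  define r21 where "(r21 :: 'n sym_gl^_^_) = map_matrix const (swap_legs r)"
  \<comment> \<open>\<open>M\<close> and \<open>N\<close> are the powers \<open>k\<close> and
    \<open>Suc k\<close> of \<open>L2\<close>; each term of the bracket supplies the one
    \<open>L2\<close> that turns \<open>M\<close> into \<open>N\<close>.\<close>
  define M where "M = kronecker (mat 1 :: 'n sym_gl^'n^'n) (mat_power L k)"
  define N where "N = kronecker (mat 1 :: 'n sym_gl^'n^'n) (mat_power L (Suc k))"
  have N: "L2 ** M = N" "M ** L2 = N"
    by (simp_all add: M_def N_def L2_def kronecker_mult mat_power_comm)
  have comm: "L1 ** N = N ** L1" "L1 ** L2 = L2 ** L1" "L1 ** M = M ** L1"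
    by (simp_all add: L1_def L2_def M_def N_def kronecker_mult)
  have "r12 + r21 = map_matrix const (flip + flip)"
    by (simp only: r12_def r21_def assms map_matrix_const_add[symmetric])
  then have sum: "r12 + r21 = flip + flip"
    by (simp only: map_matrix_const_add map_matrix_const_flip)
  have t1: "partial_trace (r21 ** L1 ** L2 ** M) = partial_trace (r21 ** N) ** L"
  proof -
    have "r21 ** L1 ** L2 ** M = r21 ** N ** L1"
      by (metis N(1) comm(1) matrix_mul_assoc)
    then show ?thesis by (simp add: L1_def partial_trace_mult_right)
  qed
  \<comment> \<open>Here \<open>L2\<close> stands to the left of \<open>r12\<close>, so cyclicity
    carries it round to \<open>M\<close>; the same happens in \<open>t3\<close>.\<close>
  have t2: "partial_trace (L1 ** L2 ** r12 ** M) = L ** partial_trace (r12 ** N)"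
  proof -
    have "partial_trace (L1 ** L2 ** r12 ** M) = L ** partial_trace (L2 ** (r12 ** M))"
      by (simp add: L1_def partial_trace_mult_left flip: matrix_mul_assoc)
    also have "partial_trace (L2 ** (r12 ** M)) = partial_trace (r12 ** M ** L2)"
      by (simp add: L2_def partial_trace_cyclic)
    finally show ?thesis by (simp add: N flip: matrix_mul_assoc)
  qed
  have t3: "partial_trace (L2 ** r12 ** L1 ** M) = partial_trace (r12 ** N) ** L"
  proof -
    have "partial_trace (L2 ** r12 ** L1 ** M) = partial_trace (L2 ** (r12 ** L1 ** M))"
      by (simp add: matrix_mul_assoc)
    also have "\<dots> = partial_trace (r12 ** L1 ** M ** L2)"
      by (simp add: L2_def partial_trace_cyclic)
    also have "r12 ** L1 ** M ** L2 = r12 ** N ** L1"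
      by (metis N(2) comm(1) matrix_mul_assoc)
    finally show ?thesis by (simp add: L1_def partial_trace_mult_right)
  qed
  have t4: "partial_trace (L1 ** r21 ** L2 ** M) = L ** partial_trace (r21 ** N)"
    by (simp add: N flip: matrix_mul_assoc) (simp add: L1_def partial_trace_mult_left)
  have "partial_trace (bracket_matrix r ** M) =
      partial_trace (r21 ** N) ** L - L ** partial_trace (r12 ** N)
      + partial_trace (r12 ** N) ** L - L ** partial_trace (r21 ** N)"
    by (simp add: bracket_matrix_def Let_def matrix_diff_rdistrib matrix_add_rdistrib
        partial_trace_add partial_trace_diff t1 t2 t3 t4 flip: r12_def r21_def)
  \<comment> \<open>The signs are such that \<open>r12\<close> and \<open>r21\<close> occur only
    through their sum on either side of \<open>L\<close>.\<close>
  also have "\<dots> = partial_trace ((r12 + r21) ** N) ** L - L ** partial_trace ((r12 + r21) ** N)"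
    by (simp add: matrix_add_rdistrib matrix_add_ldistrib partial_trace_add)
  also have "partial_trace ((r12 + r21) ** N) = mat_power L (Suc k) + mat_power L (Suc k)"
    by (simp only: sum matrix_add_rdistrib partial_trace_add N_def partial_trace_flip)
  finally show ?thesis
    by (simp only: M_def matrix_add_rdistrib matrix_add_ldistrib mat_power_comm diff_self)
qed

section \<open>Derivations applied to traces of matrix powers\<close>

lemma derivation_zero:
  assumes "derivation D"
  shows "D 0 = 0"
proof -
  have "D (0 + 0) = D 0 + D 0"
    using assms unfolding derivation_def by blast
  then show ?thesis by simp
qed

lemma derivation_one:
  assumes "derivation D"
  shows "D 1 = 0"
proof -
  have "D (1 * 1) = D 1 * 1 + 1 * D 1"
    using assms unfolding derivation_def by blast
  then show ?thesis by simp
qed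

lemma derivation_sum: "derivation D \<Longrightarrow> D (sum f A) = (\<Sum>x\<in>A. D (f x))"
  by (induction A rule: infinite_finite_induct) (auto simp: derivation_zero derivation_def)

lemma derivation_matrix_mult:
  assumes "derivation D"
  shows "map_matrix D (A ** B) = map_matrix D A ** B + A ** map_matrix D B"
proof -
  have "D (a * b) = D a * b + a * D b" for a b
    using assms by (simp add: derivation_def)
  then show ?thesis
    by (simp add: vec_eq_iff matrix_matrix_mult_def derivation_sum[OF assms] sum.distrib)
qed

text \<open>\<open>map_matrix D A\<close> need not commute with \<open>A\<close>, so the power rule
  is stated under the trace. The auxiliary \<open>B\<close> collects the factors \<open>A\<close>
  that cyclicity moves to the right: the induction hypothesis is applied to
  \<open>B ** A\<close>.\<close>

lemma trace_derivation_mat_power_mult: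
  assumes D: "derivation D" and "A ** B = B ** A"
  shows "trace (map_matrix D (mat_power A (Suc k)) ** B) =
    of_nat (Suc k) * trace (map_matrix D A ** mat_power A k ** B)"
  using assms(2)
proof (induction k arbitrary: B)
  case 0
  then show ?case by simp
next
  case (Suc k)
  have "trace (map_matrix D (mat_power A (Suc (Suc k))) ** B) =
     trace (map_matrix D A ** mat_power A (Suc k) ** B)
     + trace (A ** (map_matrix D (mat_power A (Suc k)) ** B))"
    by (subst mat_power.simps)
       (simp add: derivation_matrix_mult[OF D] matrix_add_rdistrib trace_add matrix_mul_assoc
         del: mat_power.simps)
  also have "trace (A ** (map_matrix D (mat_power A (Suc k)) ** B)) =
      trace (map_matrix D (mat_power A (Suc k)) ** (B ** A))"
    by (subst trace_mul_sym) (simp add: matrix_mul_assoc)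
  also have "\<dots> = of_nat (Suc k) * trace (map_matrix D A ** mat_power A k ** (B ** A))"
    by (rule Suc.IH) (metis Suc.prems matrix_mul_assoc)
  also have "map_matrix D A ** mat_power A k ** (B ** A) = map_matrix D A ** mat_power A (Suc k) ** B"
    by (metis Suc.prems mat_power.simps(2) mat_power_comm matrix_mul_assoc)
  finally show ?case
    by (simp add: algebra_simps)
qed

lemma derivation_trace_mat_power:
  assumes D: "derivation D"
  shows "D (trace (mat_power A (Suc k))) = of_nat (Suc k) * trace (map_matrix D A ** mat_power A k)"
proof -
  have "D (trace (mat_power A (Suc k))) = trace (map_matrix D (mat_power A (Suc k)) ** mat 1)"
    by (simp add: trace_def derivation_sum[OF D] del: mat_power.simps)
  also have "\<dots> = of_nat (Suc k) * trace (map_matrix D A ** mat_power A k ** mat 1)"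
    by (rule trace_derivation_mat_power_mult[OF D]) simp
  finally show ?thesis by simp
qed

section \<open>Centrality of the traces\<close>

theorem proposition8:
  fixes R :: "complex \<Rightarrow> complex^('n::finite \<times> 'n)^('n \<times> 'n)"
    and r :: "complex^('n \<times> 'n)^('n \<times> 'n)"
  assumes "hecke_deformation_of_flip R"
    and "classical_r_matrix R r"
  shows "\<forall>k. poisson_central (r_bracket r) (trace (mat_power L k)) \<and>
           (\<forall>i j. r_bracket r (gen i j) (trace (mat_power L k)) = 0)"
proof -
  have gens: "r_bracket r (gen i j) (trace (mat_power L k)) = 0" for i j k
  proof (cases k)
    case 0
    have D: "derivation (r_bracket r (gen i j))"
      by (rule r_bracket_biderivation)
    \<comment> \<open>The trace of the identity is a sum of ones, and a derivation kills each of
      them.\<close>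
    have "r_bracket r (gen i j) (trace (mat 1 :: 'n sym_gl^'n^'n)) =
        (\<Sum>x\<in>UNIV. r_bracket r (gen i j) ((mat 1 :: 'n sym_gl^'n^'n) $ x $ x))"
      unfolding trace_def by (rule derivation_sum[OF D])
    also have "\<dots> = 0"
      by (simp add: mat_def derivation_one[OF D])
    finally show ?thesis
      using 0 by simp
  next
    case (Suc m)
    \<comment> \<open>With \<open>i\<close> and \<open>j\<close> fixed, the summation indices
      \<open>k\<close> and \<open>s\<close> belong to the second space, so this trace is an entry of
      a partial trace.\<close>
    have "trace (map_matrix (r_bracket r (gen i j)) L ** mat_power L m) =
        (\<Sum>k\<in>UNIV. \<Sum>s\<in>UNIV. bracket_matrix r $ (i, k) $ (j, s) * mat_power L m $ s $ k)"
      by (simp add: trace_def matrix_matrix_mult_def L_def r_bracket_L1_L2)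
    also have "\<dots> = partial_trace (bracket_matrix r ** kronecker (mat 1) (mat_power L m)) $ i $ j"
      by (simp add: partial_trace_def mult_kronecker_mat1_nth)
    also have "\<dots> = 0"
      by (simp add: partial_trace_bracket_matrix add_swap_legs_eq[OF assms])
    finally show ?thesis
      unfolding Suc by (simp add: derivation_trace_mat_power r_bracket_biderivation(2)
          del: mat_power.simps)
  qed
  \<comment> \<open>The passage from generators to all \<open>f\<close>: the bracket with the trace,
    as a derivation in \<open>f\<close>, agrees with the zero derivation on the generators.\<close>
  have "derivation (\<lambda>f :: 'n sym_gl. 0 :: 'n sym_gl)"
    by (simp add: derivation_def)
  then have "r_bracket r f (trace (mat_power L k)) = 0" for f k
    using derivation_eqI[OF r_bracket_biderivation(1), of "\<lambda>f. 0" r "trace (mat_power L k)"] gens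
    by blast
  with gens show ?thesis
    by (simp add: poisson_central_def)
qed

end
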